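(* For every integer $s\ge 0$ there exist integers $c_{1r}^s$ (for $\lceil s/2\rceil\le r\le 8s+1$; the $s$ in $c_{1r}^s$ is a superscript index) such that $$\left(\Phi_2(-q)\,G_2(-q)^s\right)|U_2=\Phi_2(-q^2)\sum_{r=\lceil s/2\rceil}^{8s+1}c_{1r}^s\,G_8(q)^r$$ as power series in $q$, and $$\pi_2(c_{1r}^s)\ge 2r-s$$ for all such $r$.
   Context: Define the power series $$\Phi_2(q)=\prod_{n\ge1}\frac{1-q^{2n}}{(1-q^n)^2},\quad G_2(q)=q\prod_{n\ge1}\left(\frac{1-q^{2n}}{1-q^n}\right)^{24},\quad G_8(q)=q\prod_{n\ge1}\frac{(1-q^{8n})^4(1-q^{2n})^2}{(1-q^{4n})^2(1-q^n)^4}.$$ Equivalently, with $q=e^{2\pi i\tau}$ and $\eta$ the Dedekind eta function, $\Phi_2(q)=\eta(2\tau)/\eta(\tau)^2$, $G_2(q)=(\eta(2\tau)/\eta(\tau))^{24}$, $G_8(q)=\frac{\eta^4(8\tau)\eta^2(2\tau)}{\eta^2(4\tau)\eta^4(\tau)}$. The Atkin operator $U_2$ acts on power series in $q$ by $\left(\sum_{n\ge0}a(n)q^n\right)|U_2=\sum_{n\ge0}a(2n)q^n$. $\pi_2$ denotes the $2$-adic valuation on integers, with $\pi_2(0)=\infty$. *)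

theory Defs
  imports
    "HOL-Analysis.Infinite_Products"
    "HOL-Computational_Algebra.Computational_Algebra"
    "HOL-Library.Extended_Nat"
begin

text \<open>
  All series live in \<open>rat fps\<close>: the field of coefficients makes the library's division of
  power series available, and every quotient below has a denominator with constant term 1.
  Infinite products converge in the library's metric (the \<open>q\<close>-adic one); since the library
  indexes them from 0, the factor for \<open>n \<ge> 1\<close> is the one with index \<open>n - 1\<close>.
\<close>

definition Phi2 :: "rat fps" where
  "Phi2 = prodinf (\<lambda>m. let n = Suc m in (1 - fps_X ^ (2 * n)) / (1 - fps_X ^ n) ^ 2)"

definition G2 :: "rat fps" where
  "G2 = fps_X * prodinf (\<lambda>m. let n = Suc m in
          ((1 - fps_X ^ (2 * n)) / (1 - fps_X ^ n)) ^ 24)"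

definition G8 :: "rat fps" where
  "G8 = fps_X * prodinf (\<lambda>m. let n = Suc m in
          ((1 - fps_X ^ (8 * n)) ^ 4 * (1 - fps_X ^ (2 * n)) ^ 2) /
          ((1 - fps_X ^ (4 * n)) ^ 2 * (1 - fps_X ^ n) ^ 4))"

definition U2 :: "'a fps \<Rightarrow> 'a fps" where
  "U2 f = Abs_fps (\<lambda>n. fps_nth f (2 * n))"

definition pi2 :: "int \<Rightarrow> enat" where
  "pi2 c = (if c = 0 then \<infinity> else enat (multiplicity 2 c))"

end

theory Submission
  imports Defs
begin

text \<open>
  The series \<open>Phi2(q)\<close> is the inverse of \<open>\<phi>(-q)\<close>, where \<open>\<phi>(q) = \<Sum> q^(n^2)\<close> (over all integers \<open>n\<close>)
  is Jacobi's theta series. Hence everything can be written in terms of \<open>A = \<phi>(q)\<close> and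
  \<open>B = \<phi>(-q)\<close>. The operator \<open>U2\<close> takes \<open>F\<close> to \<open>H\<close> as soon as \<open>F(q) + F(-q) = 2 H(q^2)\<close>, and
  \<open>q \<mapsto> -q\<close> exchanges \<open>A\<close> and \<open>B\<close>, so that applying \<open>U2\<close> becomes a symmetrisation in \<open>A\<close> and \<open>B\<close>.

  Put \<open>v = A / B\<close>. Then \<open>16 G2(q) = v^8 - v^4\<close> (\<open>G2_theta_ratio\<close>) and
  \<open>16 G8(q^2) = v + 1 / v - 2\<close> (\<open>sq_G8_theta_ratio\<close>); the latter is
  symmetric under \<open>v \<mapsto> 1 / v\<close>, i.e. under \<open>q \<mapsto> -q\<close>. Eliminating \<open>v\<close> shows that \<open>G2(q)\<close> and \<open>G2(-q)\<close> are the two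
  roots of \<open>z^2 = \<sigma> z + g\<close>, where \<open>\<sigma>\<close> and \<open>g\<close> are integer polynomials in \<open>t = G8(q^2)\<close>
  (\<open>root_of_modular_equation\<close>). Consequently the symmetrisations of \<open>Phi2(-q) G2(-q)^s\<close> satisfy a
  linear recurrence of order two in \<open>s\<close> with coefficients \<open>\<sigma>\<close> and \<open>g\<close>; the cases \<open>s = 0\<close> and
  \<open>s = 1\<close> are computed explicitly, which gives an integer polynomial for every \<open>s\<close>
  (\<open>trace_eq_U2_poly\<close>).

  The bounds on the exponents and on the 2-adic valuations are read off from the same recurrence.
  The upper bound \<open>8 s + 1\<close> is a degree bound, because \<open>\<sigma>\<close> and \<open>g\<close> have degrees 8 and 4.
  Say that an integer polynomial \<open>p\<close> has weight \<open>s\<close> if its coefficient of \<open>x^r\<close> vanishes for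
  \<open>2 r < s\<close> and is divisible by \<open>2^(2r - s)\<close> otherwise. Weights add under multiplication, the
  coefficients \<open>\<sigma>\<close> and \<open>g\<close> have weights 1 and 2, and the two initial polynomials have weights 0
  and 1; so the \<open>s\<close>-th polynomial has weight \<open>s\<close> (\<open>two_adic_weight_U2_poly\<close>).

  The analytic input is Gauss's product for \<open>\<phi>(-q)\<close>, obtained as the limit of a finite identity of
  Shanks (\<open>finite_gauss\<close>). The series shows that \<open>\<phi>(q) + \<phi>(-q) = 2 \<phi>(q^4)\<close>; the product shows that
  \<open>\<phi>(q) \<phi>(-q) = \<phi>(-q^2)^2\<close>. The remaining quadratic relations follow from these two and from
  uniqueness of the solutions of functional equations that relate \<open>f(q)\<close> and \<open>f(q^2)\<close>.
\<close>

section \<open>Products in the q-adic topology\<close>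

lemma fps_X_power_dvd_iff:
  fixes f :: "'a::field fps"
  shows "fps_X ^ n dvd f \<longleftrightarrow> (\<forall>k<n. fps_nth f k = 0)"
proof
  assume "fps_X ^ n dvd f"
  then show "\<forall>k<n. fps_nth f k = 0"
    by (auto elim!: dvdE simp: fps_X_power_mult_nth)
next
  assume "\<forall>k<n. fps_nth f k = 0"
  then have "f = fps_X ^ n * Abs_fps (\<lambda>k. fps_nth f (k + n))"
    by (auto simp: fps_eq_iff fps_X_power_mult_nth)
  then show "fps_X ^ n dvd f" by (metis dvd_triv_left)
qed

text \<open>
  Convergence is handled through congruences modulo \<open>q^(N + 1)\<close>: they are compatible with sums, products
  and substitution, so that finite identities pass to the limit by divisibility arguments only.
\<close>
lemma fps_eq_if_cong_all:
  fixes f g :: "'a::field fps"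
  assumes "\<And>N. fps_X ^ Suc N dvd f - g"
  shows "f = g"
proof (rule fps_ext)
  fix n show "fps_nth f n = fps_nth g n"
    using assms[of n] unfolding fps_X_power_dvd_iff by auto
qed

lemma dvd_diff_mult:
  fixes a b c d :: "'a::comm_ring_1"
  assumes "m dvd a - b" "m dvd c - d"
  shows "m dvd a * c - b * d"
proof -
  have "a * c - b * d = (a - b) * c + b * (c - d)" by (simp add: algebra_simps)
  then show ?thesis using assms by simp
qed

lemma dvd_diff_trans:
  fixes a b c :: "'a::comm_ring_1"
  assumes "m dvd a - b" "m dvd b - c"
  shows "m dvd a - c"
  using dvd_add[OF assms] by simp

lemma dvd_diff_prod_1:
  fixes f :: "'b \<Rightarrow> 'a::comm_ring_1"
  assumes "\<And>i. i \<in> I \<Longrightarrow> m dvd f i - 1"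
  shows "m dvd prod f I - 1"
  using assms
proof (induction I rule: infinite_finite_induct)
  case (insert i I)
  then show ?case using dvd_diff_mult[of m "f i" 1 "prod f I" 1] by simp
qed simp_all

text \<open>
  The factor of index \<open>m\<close> does not affect the coefficients up to \<open>q^m\<close>. All products below have this
  shape, and the first \<open>N\<close> factors then determine the product modulo \<open>q^(N + 1)\<close>.
\<close>
definition near_one :: "(nat \<Rightarrow> 'a::field fps) \<Rightarrow> bool" where
  "near_one f \<longleftrightarrow> (\<forall>m. fps_X ^ Suc m dvd f m - 1)"

lemma near_one_partial_prod:
  assumes "near_one f" "N \<le> M"
  shows "fps_X ^ Suc N dvd (\<Prod>m<M. f m) - (\<Prod>m<N. f m)"
proof -
  have "fps_X ^ Suc N dvd (\<Prod>m=N..<M. f m) - 1"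
  proof (rule dvd_diff_prod_1)
    fix i assume "i \<in> {N..<M}"
    then have "(fps_X :: 'a fps) ^ Suc N dvd fps_X ^ Suc i"
      by (intro le_imp_power_dvd) auto
    then show "fps_X ^ Suc N dvd f i - 1"
      using assms(1) unfolding near_one_def by (meson dvd_trans)
  qed
  moreover have "(\<Prod>m<M. f m) = (\<Prod>m<N. f m) * (\<Prod>m=N..<M. f m)"
    using assms(2) by (metis lessThan_atLeast0 prod.atLeastLessThan_concat zero_le)
  ultimately show ?thesis
    by (metis dvd_mult mult.right_neutral right_diff_distrib)
qed

lemma prodinf_cong_partial_prod:
  fixes f :: "nat \<Rightarrow> 'a::field fps"
  assumes "near_one f"
  shows "fps_X ^ Suc N dvd prodinf f - (\<Prod>m<N. f m)"
proof -
  define p where "p = Abs_fps (\<lambda>k. fps_nth (\<Prod>m<k. f m) k)"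
  have p: "fps_nth p k = fps_nth (\<Prod>m<M. f m) k" if "k \<le> M" for k M
    using near_one_partial_prod[OF assms that] unfolding fps_X_power_dvd_iff p_def by auto
  have "(\<lambda>n. \<Prod>i\<le>n. f (i + 0)) \<longlonglongrightarrow> p"
  proof (rule tendsto_fpsI)
    fix k show "\<forall>\<^sub>F n in sequentially. fps_nth (\<Prod>i\<le>n. f (i + 0)) k = fps_nth p k"
    proof (rule eventually_sequentiallyI[of k])
      fix n assume "k \<le> n"
      then show "fps_nth (\<Prod>i\<le>n. f (i + 0)) k = fps_nth p k"
        using p[of k "Suc n"] by (simp only: lessThan_Suc_atMost add_0_right le_SucI)
    qed
  qed
  moreover have "p \<noteq> 0" using p[of 0 0] by auto
  \<comment> \<open>A product with limit 0 is not convergent in the sense of \<open>raw_has_prod\<close>; here the constant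
      coefficient of the limit is 1.\<close>
  ultimately have "f has_prod p"
    by (auto simp: has_prod_def raw_has_prod_def)
  then have "prodinf f = p" by (rule has_prod_unique[symmetric])
  then show ?thesis
    unfolding fps_X_power_dvd_iff using p by (auto simp: less_Suc_eq_le)
qed

lemma prodinf_eqI:
  fixes f :: "nat \<Rightarrow> 'a::field fps"
  assumes "near_one f" "\<And>N. fps_X ^ Suc N dvd p - (\<Prod>m<N. f m)"
  shows "prodinf f = p"
proof (rule fps_eq_if_cong_all)
  fix N
  have "fps_X ^ Suc N dvd (\<Prod>m<N. f m) - p"
    using assms(2)[of N] by (metis dvd_minus_iff minus_diff_eq)
  then show "fps_X ^ Suc N dvd prodinf f - p"
    using prodinf_cong_partial_prod[OF assms(1), of N] dvd_diff_trans by blast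
qed

lemma near_one_mult:
  "near_one f \<Longrightarrow> near_one g \<Longrightarrow> near_one (\<lambda>m. f m * g m)"
  unfolding near_one_def using dvd_diff_mult[where b = 1 and d = 1] by fastforce

lemma near_one_power: "near_one f \<Longrightarrow> near_one (\<lambda>m. f m ^ k)"
  by (induction k) (auto intro: near_one_mult simp: near_one_def[of "\<lambda>_. 1"])

lemma near_one_divide:
  assumes "near_one f" "near_one g"
  shows "near_one (\<lambda>m. f m / g m)"
  unfolding near_one_def
proof
  fix m
  have g: "fps_X ^ Suc m dvd g m - 1" and f: "fps_X ^ Suc m dvd f m - 1"
    using assms by (auto simp: near_one_def)
  have "fps_nth (g m) 0 = 1" using g unfolding fps_X_power_dvd_iff by auto
  then have "f m / g m - 1 = ((f m - 1) - (g m - 1)) * inverse (g m)"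
    by (simp add: fps_divide_unit algebra_simps inverse_mult_eq_1')
  then show "fps_X ^ Suc m dvd f m / g m - 1"
    using dvd_diff[OF f g] by (metis dvd_mult2)
qed

lemma near_one_fps_X:
  assumes "k > 0"
  shows "near_one (\<lambda>m. 1 - fps_X ^ (k * Suc m))" "near_one (\<lambda>m. 1 + fps_X ^ (k * Suc m))"
  using assms by (auto simp: near_one_def intro!: le_imp_power_dvd simp del: power_Suc mult_Suc_right)

lemma prodinf_mult_fps:
  assumes "near_one f" "near_one g"
  shows "prodinf (\<lambda>m. f m * g m) = prodinf f * prodinf g"
proof (rule prodinf_eqI)
  show "near_one (\<lambda>m. f m * g m)" using assms by (rule near_one_mult)
  show "fps_X ^ Suc N dvd prodinf f * prodinf g - (\<Prod>m<N. f m * g m)" for N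
    unfolding prod.distrib by (intro dvd_diff_mult prodinf_cong_partial_prod assms)
qed

lemma prodinf_power_fps:
  assumes "near_one f"
  shows "prodinf (\<lambda>m. f m ^ k) = prodinf f ^ k"
proof (induction k)
  case 0
  show ?case by (auto intro!: prodinf_eqI simp: near_one_def)
next
  case (Suc k)
  then show ?case using prodinf_mult_fps[OF assms near_one_power[OF assms]] by simp
qed

lemma fps_X_power_dvd_compose:
  fixes f h :: "'a::field fps"
  assumes "fps_X ^ n dvd f" "fps_nth h 0 = 0"
  shows "fps_X ^ n dvd f oo h"
proof -
  obtain w where "f = fps_X ^ n * w" using assms(1) by auto
  then have "f oo h = h ^ n * (w oo h)"
    using assms(2) by (simp add: fps_compose_mult_distrib fps_X_power_compose)
  moreover have "fps_X dvd h" using assms(2) fps_X_power_dvd_iff[of 1 h] by simp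
  ultimately show ?thesis by (simp add: dvd_power_same)
qed

lemma prodinf_compose:
  fixes f :: "nat \<Rightarrow> 'a::field fps"
  assumes "near_one f" "fps_nth h 0 = 0"
  shows "prodinf f oo h = prodinf (\<lambda>m. f m oo h)"
proof (rule prodinf_eqI[symmetric])
  show "near_one (\<lambda>m. f m oo h)"
    unfolding near_one_def
  proof
    fix m
    have "fps_X ^ Suc m dvd f m - 1" using assms(1) by (simp add: near_one_def)
    from fps_X_power_dvd_compose[OF this assms(2)]
    show "fps_X ^ Suc m dvd (f m oo h) - 1" by (simp add: fps_compose_sub_distrib)
  qed
  show "fps_X ^ Suc N dvd (prodinf f oo h) - (\<Prod>m<N. f m oo h)" for N
    using fps_X_power_dvd_compose[OF prodinf_cong_partial_prod[OF assms(1)] assms(2)]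
    by (simp add: fps_compose_sub_distrib fps_compose_prod_distrib[OF assms(2)])
qed

section \<open>The products at level two\<close>

text \<open>
  The two substitutions \<open>q \<mapsto> -q\<close> and \<open>q \<mapsto> q^2\<close> generate all the arguments that occur. Both are ring
  homomorphisms, so each relation proved below may be transported along them.
\<close>
abbreviation flip :: "rat fps \<Rightarrow> rat fps" where
  "flip f \<equiv> f oo (- fps_X)"

abbreviation sq :: "rat fps \<Rightarrow> rat fps" where
  "sq f \<equiv> f oo fps_X ^ 2"

lemma flip_flip: "flip (flip f) = f"
  by (simp add: fps_compose_uminus' fps_eq_iff flip: power_mult_distrib mult.assoc)

lemma flip_sq: "flip (sq f) = sq f"
  by (simp add: fps_compose_assoc[symmetric] fps_X_power_compose)

lemma sq_flip: "sq (flip f) = f oo - (fps_X ^ 2)"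
  by (simp add: fps_compose_assoc[symmetric] fps_compose_uminus)

lemma sq_nth_even: "fps_nth (sq f) (2 * n) = fps_nth f n"
proof -
  have *: "fps_nth ((fps_X ^ 2) ^ i) (2 * n) = (if i = n then 1 else 0 :: rat)" for i
    unfolding power_mult[symmetric] by (auto simp: fps_X_power_iff)
  have "(\<Sum>i=0..2 * n. fps_nth f i * fps_nth ((fps_X ^ 2) ^ i) (2 * n)) =
      (\<Sum>i=0..2 * n. if i = n then fps_nth f i else 0)"
    by (intro sum.cong refl) (simp only: * split: if_split, simp)
  then show ?thesis by (simp add: fps_compose_nth)
qed

lemmas compose_hom = fps_compose_mult_distrib fps_compose_add_distrib fps_compose_sub_distrib
  fps_compose_power[symmetric] fps_compose_uminus fps_X_power_compose fps_divide_compose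

text \<open>
  The product \<open>\<Prod> (1 + q^n)\<close>, i.e. \<open>\<eta>(2\<tau>) / \<eta>(\<tau>)\<close> up to a power of \<open>q\<close>; it generates the partitions
  into distinct parts.
\<close>
definition distinct_prod :: "rat fps" where
  "distinct_prod = prodinf (\<lambda>m. 1 + fps_X ^ Suc m)"

text \<open>Jacobi's \<open>\<phi>(-q)\<close>, defined by its product; \<open>\<phi>(q)\<close> itself is its image under \<open>flip\<close>.\<close>
definition theta_minus :: "rat fps" where
  "theta_minus = prodinf (\<lambda>m. (1 - fps_X ^ Suc m) / (1 + fps_X ^ Suc m))"

lemma divide_fps_eqI:
  fixes f g h :: "'a::field fps"
  assumes "fps_nth g 0 \<noteq> 0" "f = h * g"
  shows "f / g = h"
  using assms by (simp add: fps_divide_unit mult.assoc inverse_mult_eq_1')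

lemma fps_divide_times_eq:
  fixes f g :: "'a::field fps"
  assumes "fps_nth g 0 \<noteq> 0"
  shows "f / g * g = f"
  using assms by (simp add: fps_divide_unit mult.assoc inverse_mult_eq_1)

lemma near_one_basic:
  "near_one (\<lambda>m. 1 - fps_X ^ Suc m)" "near_one (\<lambda>m. 1 + fps_X ^ Suc m)"
  using near_one_fps_X[of 1] by simp_all

lemma near_one_theta: "near_one (\<lambda>m. (1 - fps_X ^ Suc m) / (1 + fps_X ^ Suc m))"
  by (intro near_one_divide near_one_basic)

lemma distinct_prod_compose:
  assumes "k > 0"
  shows "distinct_prod oo fps_X ^ k = prodinf (\<lambda>m. 1 + fps_X ^ (k * Suc m))"
  unfolding distinct_prod_def using assms
  by (subst prodinf_compose)
    (simp_all add: near_one_basic compose_hom power_mult del: power_Suc mult_Suc_right)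

lemma theta_minus_compose:
  assumes "k > 0"
  shows "theta_minus oo fps_X ^ k =
    prodinf (\<lambda>m. (1 - fps_X ^ (k * Suc m)) / (1 + fps_X ^ (k * Suc m)))"
proof -
  have "((1 - fps_X ^ Suc m) / (1 + fps_X ^ Suc m) oo fps_X ^ k) =
      (1 - fps_X ^ (k * Suc m)) / (1 + fps_X ^ (k * Suc m) :: rat fps)" for m
    using assms by (subst fps_divide_compose)
      (simp_all add: compose_hom power_mult del: power_Suc mult_Suc_right)
  moreover have "fps_nth (fps_X ^ k :: rat fps) 0 = 0" using assms by simp
  ultimately show ?thesis
    unfolding theta_minus_def by (simp only: prodinf_compose[OF near_one_theta])
qed

lemma Phi2_theta_minus: "Phi2 * theta_minus = 1"
proof -
  let ?f = "\<lambda>m. (1 - fps_X ^ (2 * Suc m)) / (1 - fps_X ^ Suc m) ^ 2 :: rat fps"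
  let ?g = "\<lambda>m. (1 - fps_X ^ Suc m) / (1 + fps_X ^ Suc m) :: rat fps"
  have "?f m * ?g m = 1" for m
  proof -
    define u :: "rat fps" where "u = fps_X ^ Suc m"
    have u: "fps_X ^ (2 * Suc m) = u ^ 2" "fps_nth u 0 = 0"
      unfolding u_def by (simp_all add: power_mult mult.commute[of 2] del: mult_Suc mult_Suc_right)
    have "(1 - u ^ 2) / (1 - u) ^ 2 * ((1 - u) / (1 + u)) = 1"
    proof -
      have "inverse (1 - u) * (1 - u) = 1" "inverse (1 + u) * (1 + u) = 1"
        using u(2) by (simp_all add: inverse_mult_eq_1)
      moreover have "(1 - u ^ 2) / (1 - u) ^ 2 * ((1 - u) / (1 + u)) =
          (inverse (1 - u) * (1 - u)) ^ 2 * (inverse (1 + u) * (1 + u))"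
        using u(2) by (simp add: fps_divide_unit fps_inverse_power)
          (simp add: power2_eq_square algebra_simps)
      ultimately show ?thesis by simp
    qed
    then show ?thesis unfolding u(1) u_def .
  qed
  moreover have "near_one ?f"
    by (intro near_one_divide near_one_power near_one_basic near_one_fps_X) auto
  moreover have "prodinf (\<lambda>_. 1 :: rat fps) = 1"
    by (rule prodinf_eqI) (auto simp: near_one_def)
  ultimately show ?thesis
    using prodinf_mult_fps[OF _ near_one_theta, of ?f]
    by (simp add: Phi2_def theta_minus_def Let_def)
qed

lemma G2_distinct_prod: "G2 = fps_X * distinct_prod ^ 24"
proof -
  have "(1 - fps_X ^ (2 * Suc m)) / (1 - fps_X ^ Suc m) = (1 + fps_X ^ Suc m :: rat fps)" for m
  proof (rule divide_fps_eqI)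
    define u :: "rat fps" where "u = fps_X ^ Suc m"
    have "fps_X ^ (2 * Suc m) = u ^ 2"
      unfolding u_def by (simp only: power_mult mult.commute[of 2])
    then show "1 - fps_X ^ (2 * Suc m) = (1 + fps_X ^ Suc m) * (1 - fps_X ^ Suc m :: rat fps)"
      unfolding u_def[symmetric] by (simp add: power2_eq_square algebra_simps)
  qed simp
  then show ?thesis
    unfolding G2_def Let_def distinct_prod_def
    by (simp only: prodinf_power_fps[OF near_one_basic(2)])
qed

text \<open>
  Split \<open>1 - u^8\<close>, \<open>1 - u^4\<close> and \<open>1 - u^2\<close> for \<open>u = q^n\<close> into \<open>1 - u\<close> and factors \<open>1 + u^k\<close>. The powers
  of \<open>1 - u\<close> cancel, so no quotient remains.
\<close>
lemma G8_distinct_prod: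
  "G8 = fps_X * distinct_prod ^ 4 * sq distinct_prod ^ 2 * sq (sq distinct_prod) ^ 4"
proof -
  have "((1 - fps_X ^ (8 * Suc m)) ^ 4 * (1 - fps_X ^ (2 * Suc m)) ^ 2) /
          ((1 - fps_X ^ (4 * Suc m)) ^ 2 * (1 - fps_X ^ Suc m) ^ 4) =
        (1 + fps_X ^ Suc m) ^ 4 * ((1 + fps_X ^ (2 * Suc m)) ^ 2 *
          (1 + fps_X ^ (4 * Suc m) :: rat fps) ^ 4)" for m
  proof (rule divide_fps_eqI)
    define u :: "rat fps" where "u = fps_X ^ Suc m"
    have u: "fps_X ^ (2 * Suc m) = u ^ 2" "fps_X ^ (4 * Suc m) = u ^ 4"
      "fps_X ^ (8 * Suc m) = u ^ 8"
      unfolding u_def by (simp_all only: power_mult mult.commute[of 2] mult.commute[of 4]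
          mult.commute[of 8])
    have "1 - u ^ 8 = (1 + u ^ 4) * ((1 + u ^ 2) * ((1 + u) * (1 - u)))"
      "1 - u ^ 4 = (1 + u ^ 2) * ((1 + u) * (1 - u))" "1 - u ^ 2 = (1 + u) * (1 - u)"
      by algebra+
    moreover have "(x * (y * (v * w))) ^ 4 * (v * w) ^ 2 =
        v ^ 4 * (y ^ 2 * x ^ 4) * ((y * (v * w)) ^ 2 * w ^ 4)" for v w x y :: "rat fps"
      by algebra
    ultimately show "(1 - fps_X ^ (8 * Suc m)) ^ 4 * (1 - fps_X ^ (2 * Suc m)) ^ 2 =
        (1 + fps_X ^ Suc m) ^ 4 * ((1 + fps_X ^ (2 * Suc m)) ^ 2 *
          (1 + fps_X ^ (4 * Suc m) :: rat fps) ^ 4) *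
        ((1 - fps_X ^ (4 * Suc m)) ^ 2 * (1 - fps_X ^ Suc m) ^ 4)"
      unfolding u u_def[symmetric] by (simp only:)
  qed simp
  moreover have "sq (sq distinct_prod) = distinct_prod oo fps_X ^ 4"
    by (simp add: fps_compose_assoc[symmetric] fps_X_power_compose flip: power_mult)
  moreover have "near_one (\<lambda>m. 1 + fps_X ^ (2 * Suc m) :: rat fps)"
    "near_one (\<lambda>m. 1 + fps_X ^ (4 * Suc m) :: rat fps)"
    by (rule near_one_fps_X; simp)+
  ultimately show ?thesis
    unfolding G8_def Let_def
    by (simp only: prodinf_mult_fps prodinf_power_fps near_one_mult near_one_power near_one_basic
        distinct_prod_compose distinct_prod_def[symmetric] mult.assoc zero_less_numeral)
qed

text \<open>
  This relation expresses \<open>distinct_prod\<close> at \<open>q^2\<close> through its value at \<open>q\<close> and theta series. It is what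
  links the exponents of \<open>G2\<close> and \<open>G8\<close>.
\<close>
lemma theta_minus_distinct_prod:
  "sq theta_minus * sq distinct_prod = distinct_prod ^ 2 * theta_minus"
proof -
  have "(1 - fps_X ^ (2 * Suc m)) / (1 + fps_X ^ (2 * Suc m)) * (1 + fps_X ^ (2 * Suc m)) =
      (1 + fps_X ^ Suc m) ^ 2 * ((1 - fps_X ^ Suc m) / (1 + fps_X ^ Suc m) :: rat fps)" for m
  proof -
    define u :: "rat fps" where "u = fps_X ^ Suc m"
    have u: "fps_X ^ (2 * Suc m) = u ^ 2" "fps_nth u 0 = 0"
      unfolding u_def by (simp_all add: power_mult mult.commute[of 2] del: mult_Suc mult_Suc_right)
    have "(1 - u ^ 2) / (1 + u ^ 2) * (1 + u ^ 2) = 1 - u ^ 2"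
      "(1 - u) / (1 + u) * (1 + u) = 1 - u"
      using u(2) by (intro fps_divide_times_eq; simp add: fps_nth_power_0)+
    moreover have "1 - u ^ 2 = (1 + u) * (1 - u)" by (simp add: power2_eq_square algebra_simps)
    ultimately show ?thesis unfolding u(1) u_def[symmetric]
      by (metis mult.commute mult.left_commute power2_eq_square)
  qed
  moreover have "near_one (\<lambda>m. 1 + fps_X ^ (2 * Suc m) :: rat fps)"
    "near_one (\<lambda>m. (1 - fps_X ^ (2 * Suc m)) / (1 + fps_X ^ (2 * Suc m)) :: rat fps)"
    by (intro near_one_divide near_one_fps_X; simp)+
  ultimately show ?thesis
    unfolding distinct_prod_compose[OF zero_less_numeral] theta_minus_compose[OF zero_less_numeral]
    unfolding theta_minus_def distinct_prod_def
    by (simp only: prodinf_mult_fps[symmetric] prodinf_power_fps[symmetric] near_one_mult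
        near_one_power near_one_basic near_one_theta)
qed

section \<open>The theta series\<close>

text \<open>
  In \<open>\<phi>(-q) \<phi>(q)\<close> the factors for odd \<open>n\<close> cancel, since there \<open>q \<mapsto> -q\<close> inverts \<open>(1 - q^n) / (1 + q^n)\<close>,
  and the factors for even \<open>n\<close> are squared.
\<close>
lemma theta_minus_mult_flip: "theta_minus * flip theta_minus = sq theta_minus ^ 2"
proof (rule fps_eq_if_cong_all)
  fix N
  define f :: "nat \<Rightarrow> rat fps" where "f m = (1 - fps_X ^ Suc m) / (1 + fps_X ^ Suc m)" for m
  have cong: "fps_X ^ Suc M dvd theta_minus - (\<Prod>m<M. f m)" for M
    unfolding theta_minus_def f_def by (rule prodinf_cong_partial_prod[OF near_one_theta])
  have f: "f m * (1 + fps_X ^ Suc m) = 1 - fps_X ^ Suc m" for m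
    unfolding f_def by (intro fps_divide_times_eq) simp
  have flip_f: "flip (f m) * (1 + (- fps_X) ^ Suc m) = 1 - (- fps_X) ^ Suc m" for m
    using arg_cong[OF f, of flip m] by (simp add: compose_hom del: power_Suc)
  have sq_f: "sq (f m) * (1 + fps_X ^ (2 * Suc m)) = 1 - fps_X ^ (2 * Suc m)" for m
    using arg_cong[OF f, of sq m]
    by (simp add: compose_hom flip: power_mult del: power_Suc mult_Suc_right)
  have nz: "1 + fps_X ^ Suc m \<noteq> (0 :: rat fps)" "1 - fps_X ^ Suc m \<noteq> (0 :: rat fps)" for m
  proof -
    have "fps_nth (1 + fps_X ^ Suc m) 0 = (1 :: rat)" "fps_nth (1 - fps_X ^ Suc m) 0 = (1 :: rat)"
      by simp_all
    then show "1 + fps_X ^ Suc m \<noteq> (0 :: rat fps)" "1 - fps_X ^ Suc m \<noteq> (0 :: rat fps)"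
      by auto
  qed
  \<comment> \<open>The factor with index \<open>m\<close> belongs to \<open>n = m + 1\<close>, so even indices belong to odd \<open>n\<close>.\<close>
  have even: "f (2 * m) * flip (f (2 * m)) = 1" for m
  proof -
    have "(- fps_X) ^ Suc (2 * m) = - (fps_X ^ Suc (2 * m) :: rat fps)" by simp
    with flip_f[of "2 * m"]
    have "flip (f (2 * m)) * (1 - fps_X ^ Suc (2 * m)) = 1 + fps_X ^ Suc (2 * m)" by simp
    moreover have "(x * y) * (p * p') = 1 * (p * p')" if "x * p = p'" "y * p' = p"
      for x y p p' :: "rat fps"
    proof -
      have "(x * y) * (p * p') = (x * p) * (y * p')" by (simp only: mult_ac)
      then have "(x * y) * (p * p') = p' * p" by (simp only: that)
      then show ?thesis by (simp only: mult_1_left mult.commute[of p' p])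
    qed
    ultimately have "(f (2 * m) * flip (f (2 * m))) * ((1 + fps_X ^ Suc (2 * m)) * (1 - fps_X ^ Suc (2 * m))) =
        1 * ((1 + fps_X ^ Suc (2 * m)) * (1 - fps_X ^ Suc (2 * m)))"
      using f by blast
    then show ?thesis
      using nz[of "2 * m"] by (simp only: mult_right_cancel mult_eq_0_iff simp_thms)
  qed
  have odd: "f (Suc (2 * m)) * flip (f (Suc (2 * m))) = sq (f m) ^ 2" for m
  proof -
    have "(- fps_X) ^ Suc (Suc (2 * m)) = (fps_X ^ Suc (Suc (2 * m)) :: rat fps)"
      "2 * Suc m = Suc (Suc (2 * m))" by simp_all
    with flip_f[of "Suc (2 * m)"] sq_f[of m] f[of "Suc (2 * m)"]
    have "flip (f (Suc (2 * m))) * (1 + fps_X ^ Suc (Suc (2 * m))) =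
        sq (f m) * (1 + fps_X ^ Suc (Suc (2 * m)))"
      "f (Suc (2 * m)) * (1 + fps_X ^ Suc (Suc (2 * m))) =
        sq (f m) * (1 + fps_X ^ Suc (Suc (2 * m)))"
      by (simp_all only:)
    then have "flip (f (Suc (2 * m))) = sq (f m)" "f (Suc (2 * m)) = sq (f m)"
      using nz(1)[of "Suc (2 * m)"] by (simp_all only: mult_right_cancel simp_thms)
    then show ?thesis by (simp add: power2_eq_square)
  qed
  have finite: "(\<Prod>m<2 * M. f m) * flip (\<Prod>m<2 * M. f m) = sq (\<Prod>m<M. f m) ^ 2" for M
  proof (induction M)
    case (Suc M)
    have "(\<Prod>m<2 * Suc M. f m) * flip (\<Prod>m<2 * Suc M. f m) =
        ((\<Prod>m<2 * M. f m) * flip (\<Prod>m<2 * M. f m)) *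
        (f (2 * M) * flip (f (2 * M))) * (f (Suc (2 * M)) * flip (f (Suc (2 * M))))"
      by (simp add: compose_hom mult_ac)
    also have "\<dots> = sq (\<Prod>m<Suc M. f m) ^ 2"
      unfolding Suc even odd by (simp add: compose_hom power_mult_distrib)
    finally show ?case .
  qed simp
  have "fps_X ^ Suc N dvd (fps_X :: rat fps) ^ Suc (2 * N)" by (rule le_imp_power_dvd) simp
  then have c2: "fps_X ^ Suc N dvd theta_minus - (\<Prod>m<2 * N. f m)"
    using cong[of "2 * N"] dvd_trans by blast
  then have "fps_X ^ Suc N dvd theta_minus * flip theta_minus -
      (\<Prod>m<2 * N. f m) * flip (\<Prod>m<2 * N. f m)"
    using fps_X_power_dvd_compose[OF c2, of "- fps_X"]
    by (intro dvd_diff_mult) (simp_all add: compose_hom)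
  moreover have "fps_X ^ Suc N dvd sq (\<Prod>m<N. f m) ^ 2 - sq theta_minus ^ 2"
    unfolding power2_eq_square[of "sq h" for h]
    using fps_X_power_dvd_compose[OF cong[of N], of "fps_X ^ 2"]
    by (intro dvd_diff_mult) (simp_all add: compose_hom dvd_diff_commute)
  ultimately show "fps_X ^ Suc N dvd theta_minus * flip theta_minus - sq theta_minus ^ 2"
    unfolding finite by (rule dvd_diff_trans)
qed

text \<open>
  The cross-multiplied form of the step that makes Shanks's sum telescope, with \<open>a = q^s\<close>,
  \<open>b = q^(n + 1)\<close>, \<open>z = q^(s (n + 1))\<close> and \<open>w = (-1)^s\<close>.
\<close>
lemma gauss_telescoping_step:
  fixes a b :: "'a::idom"
  assumes "1 + a \<noteq> 0" "1 + b \<noteq> 0"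
    and "e * (1 + a) = 2" "e' * (1 + b) = 2" "r1 * (1 + b) = r0 * (1 - b)" "r * (1 + a) = r0 * (1 - a)"
  shows "w * e * r1 * (z * a) - w * e * r0 * z = - w * e' * r0 * (z * b) - w * e' * r * z"
proof -
  have "(w * e * r1 * (z * a) - w * e * r0 * z) * ((1 + a) * (1 + b)) =
      w * z * (e * (1 + a)) * (a * (r1 * (1 + b)) - r0 * (1 + b))"
    by algebra
  also have "\<dots> = - w * z * (e' * (1 + b)) * (r0 * b * (1 + a) + r * (1 + a))"
    unfolding assms(3-6) by algebra
  also have "\<dots> = (- w * e' * r0 * (z * b) - w * e' * r * z) * ((1 + a) * (1 + b))"
    by algebra
  finally show ?thesis using assms(1,2) by simp
qed

text \<open>
  Shanks's finite form of Gauss's theorem. On the right, the term \<open>s = 0\<close> is the partial product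
  \<open>P n\<close>, while the other terms are divisible by \<open>q^(n + 1)\<close>; hence the series and the product agree up to
  \<open>q^n\<close>. The proof is by induction on \<open>n\<close>: the difference of consecutive right-hand sides telescopes
  to \<open>2 (-1)^n q^(n^2)\<close>.
\<close>
lemma finite_gauss:
  fixes q :: "'a::field fps" and P :: "nat \<Rightarrow> 'a fps"
  assumes q: "fps_nth q 0 = 0" and char: "(2::'a) \<noteq> 0"
    and P: "\<And>n. P n = (\<Prod>m<n. (1 - q ^ Suc m) / (1 + q ^ Suc m))"
  shows "1 + 2 * (\<Sum>s=1..n. (-1) ^ s * q ^ (s ^ 2)) =
    (\<Sum>s\<le>n. (-1) ^ s * (2 / (1 + q ^ s)) * (P n / P s) * q ^ (s * Suc n))"
proof -
  define e where "e s = 2 / (1 + q ^ s)" for s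
  have q_pow: "fps_nth (q ^ s) 0 = (if s = 0 then 1 else 0)" for s
    using q by (simp add: fps_nth_power_0 power_0_left)
  have unit: "fps_nth (1 + q ^ s) 0 \<noteq> 0" for s
    using char by (simp add: q_pow)
  then have unit_nz: "1 + q ^ s \<noteq> 0" for s
    by (metis fps_zero_nth)
  have e: "e s * (1 + q ^ s) = 2" for s
    unfolding e_def by (rule fps_divide_times_eq[OF unit])
  have P_Suc: "P (Suc n) * (1 + q ^ Suc n) = P n * (1 - q ^ Suc n)" for n
    using fps_divide_times_eq[OF unit, of "1 - q ^ Suc n" "Suc n"]
    by (simp add: P mult.assoc del: power_Suc)
  have unitP: "fps_nth (P n) 0 = 1" for n
  proof (induction n)
    case 0
    show ?case by (simp add: P)
  next
    case (Suc n)
    have "fps_nth (P (Suc n) * (1 + q ^ Suc n)) 0 = fps_nth (P n * (1 - q ^ Suc n)) 0"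
      by (simp only: P_Suc)
    then show ?case using Suc by (simp add: q_pow del: power_Suc)
  qed
  have P_nz: "P n \<noteq> 0" for n using unitP[of n] by auto
  define r where "r n s = P n / P s" for n s
  have r: "r n s * P s = P n" for n s
    unfolding r_def by (rule fps_divide_times_eq) (simp add: unitP)
  have r_self: "r n n = 1" for n using r[of n n] P_nz[of n] by simp
  have r_left: "r (Suc n) s * (1 + q ^ Suc n) = r n s * (1 - q ^ Suc n)" for n s
  proof -
    have "r (Suc n) s * (1 + q ^ Suc n) * P s = (r (Suc n) s * P s) * (1 + q ^ Suc n)"
      by (simp only: mult_ac)
    also have "\<dots> = (r n s * P s) * (1 - q ^ Suc n)" by (simp only: r P_Suc)
    also have "\<dots> = r n s * (1 - q ^ Suc n) * P s" by (simp only: mult_ac)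
    finally have "r (Suc n) s * (1 + q ^ Suc n) * P s = r n s * (1 - q ^ Suc n) * P s" .
    then show ?thesis using P_nz[of s] by simp
  qed
  have r_right: "r n s * (1 + q ^ Suc s) = r n (Suc s) * (1 - q ^ Suc s)" for n s
  proof -
    have "r n s * (1 + q ^ Suc s) * P s = (r n s * P s) * (1 + q ^ Suc s)"
      by (simp only: mult_ac)
    also have "\<dots> = r n (Suc s) * (P (Suc s) * (1 + q ^ Suc s))" by (simp only: r mult.assoc[symmetric])
    also have "\<dots> = r n (Suc s) * (1 - q ^ Suc s) * P s" by (simp only: P_Suc mult_ac)
    finally have "r n s * (1 + q ^ Suc s) * P s = r n (Suc s) * (1 - q ^ Suc s) * P s" .
    then show ?thesis using P_nz[of s] by simp
  qed
  define t where "t n s = (-1) ^ s * e s * r n s * q ^ (s * Suc n)" for n s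
  have "1 + 2 * (\<Sum>s=1..n. (-1) ^ s * q ^ (s ^ 2)) = (\<Sum>s\<le>n. t n s)"
  proof (induction n)
    case 0
    have "e 0 * 2 = 1 * 2" using e[of 0] by simp
    moreover have "(2 :: 'a fps) \<noteq> 0" using unit_nz[of 0] by simp
    ultimately have "e 0 = 1" by (simp only: mult_right_cancel simp_thms)
    then show ?case by (simp add: t_def r_self)
  next
    case (Suc n)
    \<comment> \<open>The value at 0 is the one forced by the factor \<open>1 - q^0 = 0\<close> in the recurrence for
        \<open>P n / P s\<close>.\<close>
    define U where "U s = - ((-1) ^ s) * e (Suc n) * (if s = 0 then 0 else r n (s - 1)) *
      q ^ (s * Suc n)" for s
    have tele: "t (Suc n) s - t n s = U s - U (Suc s)" for s
    proof -
      have "t (Suc n) s - t n s = (-1) ^ s * e s * r (Suc n) s * (q ^ (s * Suc n) * q ^ s) -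
          (-1) ^ s * e s * r n s * q ^ (s * Suc n)"
        by (simp add: t_def flip: power_add) (simp add: algebra_simps)
      also have "\<dots> = - ((-1) ^ s) * e (Suc n) * r n s * (q ^ (s * Suc n) * q ^ Suc n) -
          (-1) ^ s * e (Suc n) * (if s = 0 then 0 else r n (s - 1)) * q ^ (s * Suc n)"
      proof (rule gauss_telescoping_step[OF unit_nz unit_nz e e r_left])
        show "(if s = 0 then 0 else r n (s - 1)) * (1 + q ^ s) = r n s * (1 - q ^ s)"
          using r_right[of n "s - 1"] by (cases s) simp_all
      qed
      also have "\<dots> = U s - U (Suc s)"
        by (simp add: U_def power_add mult_ac)
      finally show ?thesis .
    qed
    have "(\<Sum>s\<le>Suc n. t (Suc n) s) =
        (\<Sum>s\<le>n. t n s) + ((\<Sum>s<Suc n. t (Suc n) s - t n s) + t (Suc n) (Suc n))"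
      by (simp add: sum_subtractf lessThan_Suc_atMost del: sum.lessThan_Suc)
    also have "(\<Sum>s<Suc n. t (Suc n) s - t n s) = U 0 - U (Suc n)"
      unfolding tele by (rule sum_lessThan_telescope')
    also have "U 0 - U (Suc n) + t (Suc n) (Suc n) =
        (-1) ^ Suc n * (e (Suc n) * (1 + q ^ Suc n)) * q ^ (Suc n * Suc n)"
      by (simp add: U_def t_def r_self algebra_simps power_add)
    finally have "(\<Sum>s\<le>Suc n. t (Suc n) s) =
        (\<Sum>s\<le>n. t n s) + (-1) ^ Suc n * 2 * q ^ (Suc n ^ 2)"
      unfolding e by (simp only: power2_eq_square)
    with Suc show ?case by (simp add: algebra_simps)
  qed
  then show ?thesis by (simp only: t_def e_def r_def)
qed

lemma theta_minus_cong:
  "fps_X ^ Suc N dvd theta_minus - (1 + 2 * (\<Sum>s=1..N. (-1) ^ s * fps_X ^ (s ^ 2)))"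
proof -
  define P :: "nat \<Rightarrow> rat fps" where "P n = (\<Prod>m<n. (1 - fps_X ^ Suc m) / (1 + fps_X ^ Suc m))" for n
  define t where "t s = (-1) ^ s * (2 / (1 + fps_X ^ s)) * (P N / P s) * fps_X ^ (s * Suc N)" for s
  have "t 0 = P N" by (simp add: t_def P_def fps_divide_unit)
  moreover have "1 + 2 * (\<Sum>s=1..N. (-1) ^ s * fps_X ^ (s ^ 2)) = (\<Sum>s\<le>N. t s)"
    unfolding t_def by (rule finite_gauss) (simp_all add: P_def)
  ultimately have eq: "P N - (1 + 2 * (\<Sum>s=1..N. (-1) ^ s * fps_X ^ (s ^ 2))) = - (\<Sum>s=1..N. t s)"
    by (simp add: atMost_atLeast0 sum.atLeast_Suc_atMost)
  have "fps_X ^ Suc N dvd t s" if "s \<in> {1..N}" for s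
    using that mult_le_mono1[of 1 s "Suc N"] unfolding t_def
    by (intro dvd_mult le_imp_power_dvd) simp
  then have "fps_X ^ Suc N dvd P N - (1 + 2 * (\<Sum>s=1..N. (-1) ^ s * fps_X ^ (s ^ 2)))"
    unfolding eq by (auto intro: dvd_sum)
  moreover have "fps_X ^ Suc N dvd theta_minus - P N"
    unfolding theta_minus_def P_def by (rule prodinf_cong_partial_prod[OF near_one_theta])
  ultimately show ?thesis by (rule dvd_diff_trans[rotated])
qed

text \<open>
  Only the squares \<open>n^2\<close> of even \<open>n\<close> survive in \<open>\<phi>(q) + \<phi>(-q)\<close>, which leaves \<open>2 \<phi>(q^4)\<close>.
\<close>
lemma theta_minus_plus_flip:
  "theta_minus + flip theta_minus = 2 * sq (sq (flip theta_minus))"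
proof (rule fps_eq_if_cong_all)
  fix N
  define T :: "nat \<Rightarrow> rat fps" where "T n = 1 + 2 * (\<Sum>s=1..n. (-1) ^ s * fps_X ^ (s ^ 2))" for n
  have cong: "fps_X ^ Suc n dvd theta_minus - T n" for n
    unfolding T_def by (rule theta_minus_cong)
  have T_Suc: "T (Suc n) = T n + 2 * ((-1) ^ Suc n * fps_X ^ (Suc n ^ 2))" for n
    by (simp add: T_def algebra_simps)
  have flip_T_Suc: "flip (T (Suc n)) = flip (T n) + 2 * fps_X ^ (Suc n ^ 2)" for n
  proof -
    have "even (Suc n ^ 2) = even (Suc n)" by (simp add: power2_eq_square)
    then have "(-1) ^ Suc n * (- fps_X) ^ (Suc n ^ 2) = (fps_X ^ (Suc n ^ 2) :: rat fps)"
      by (cases "even (Suc n)") (simp_all add: power_minus_odd del: power_Suc)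
    then show ?thesis
      unfolding T_Suc by (simp add: compose_hom del: power_Suc)
  qed
  have finite: "T (2 * n) + flip (T (2 * n)) = 2 * sq (sq (flip (T n)))" for n
  proof (induction n)
    case 0
    show ?case by (simp add: T_def)
  next
    case (Suc n)
    have "(Suc (Suc (2 * n))) ^ 2 = 2 * (2 * Suc n ^ 2)" by (simp add: power2_eq_square)
    then have "sq (sq (fps_X ^ (Suc n ^ 2))) = fps_X ^ (Suc (Suc (2 * n)) ^ 2)"
      by (simp add: compose_hom flip: power_mult)
    then have "sq (sq (flip (T (Suc n)))) =
        sq (sq (flip (T n))) + 2 * fps_X ^ (Suc (Suc (2 * n)) ^ 2)"
      unfolding flip_T_Suc by (simp add: fps_compose_add_distrib fps_compose_mult_distrib)
    with Suc show ?case
      by (simp add: flip_T_Suc) (simp add: T_Suc algebra_simps)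
  qed
  have "fps_X ^ Suc N dvd (fps_X :: rat fps) ^ Suc (2 * N)" by (rule le_imp_power_dvd) simp
  then have c2: "fps_X ^ Suc N dvd theta_minus - T (2 * N)"
    using cong[of "2 * N"] dvd_trans by blast
  then have "fps_X ^ Suc N dvd (theta_minus + flip theta_minus) - (T (2 * N) + flip (T (2 * N)))"
    using dvd_add[OF c2 fps_X_power_dvd_compose[OF c2, of "- fps_X"]]
    by (simp add: compose_hom algebra_simps)
  moreover have "fps_X ^ Suc N dvd 2 * sq (sq (flip (T N))) - 2 * sq (sq (flip theta_minus))"
  proof -
    have "fps_X ^ Suc N dvd sq (sq (flip (theta_minus - T N)))"
      using cong[of N] by (intro fps_X_power_dvd_compose) simp_all
    from dvd_mult[OF this, of "-2"] show ?thesis by (simp add: compose_hom algebra_simps)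
  qed
  ultimately show "fps_X ^ Suc N dvd theta_minus + flip theta_minus - 2 * sq (sq (flip theta_minus))"
    unfolding finite by (rule dvd_diff_trans)
qed

section \<open>Quadratic theta identities\<close>

lemma fps_nth_0_one_imp_nz: "fps_nth f 0 = 1 \<Longrightarrow> f \<noteq> (0 :: 'a::zero_neq_one fps)"
  by auto

text \<open>Substituting \<open>q^2\<close> doubles the order of vanishing, whereas scaling preserves it.\<close>
lemma eq_zero_if_eq_scaled_sq:
  assumes "f = fps_const c * sq f" "fps_nth f 0 = 0"
  shows "f = 0"
proof (rule ccontr)
  assume "f \<noteq> 0"
  then have "c \<noteq> 0" "sq f \<noteq> 0" using assms(1) by auto
  then have "subdegree f = 2 * subdegree f"
    by (subst assms(1)) (simp add: mult.commute)
  then have "subdegree f = 0" by simp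
  with assms(2) \<open>f \<noteq> 0\<close> show False by (metis nth_subdegree_nonzero)
qed

text \<open>
  Two solutions \<open>f\<close>, \<open>g\<close> of \<open>f(q)^2 = M f(q^2)\<close> with the same leading term \<open>c q\<close> agree: for the
  difference \<open>h\<close> one has \<open>h (f + g) = M h(q^2)\<close>, where the left-hand side vanishes to order
  \<open>ord h + 1\<close> and the right-hand side to order at least \<open>2 ord h \<ge> ord h + 2\<close>.
\<close>
lemma square_eq_mult_sq_unique:
  assumes f: "f ^ 2 = M * sq f" and g: "g ^ 2 = M * sq g"
    and "fps_nth f 0 = 0" "fps_nth g 0 = 0" "fps_nth f 1 = fps_nth g 1" "fps_nth f 1 \<noteq> 0"
  shows "f = g"
proof (rule ccontr)
  assume "f \<noteq> g"
  define h where "h = f - g"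
  have "h \<noteq> 0" using \<open>f \<noteq> g\<close> by (simp add: h_def)
  have "subdegree (f + g) = 1"
    using assms(3-6) by (intro subdegreeI) auto
  have eq: "h * (f + g) = M * sq h"
    using f g by (simp add: h_def compose_hom power2_eq_square algebra_simps)
  have "subdegree h \<ge> 2"
    using assms(3-5) \<open>h \<noteq> 0\<close> by (intro subdegree_geI) (auto simp: h_def less_2_cases_iff)
  have "f + g \<noteq> 0" using \<open>subdegree (f + g) = 1\<close> by auto
  then have nz: "h * (f + g) \<noteq> 0" using \<open>h \<noteq> 0\<close> by simp
  then have "M \<noteq> 0" "sq h \<noteq> 0" unfolding eq by auto
  then have "subdegree h + 1 = subdegree M + 2 * subdegree h"
    using arg_cong[OF eq, of subdegree] \<open>h \<noteq> 0\<close> \<open>f + g \<noteq> 0\<close> \<open>subdegree (f + g) = 1\<close>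
    by simp
  with \<open>subdegree h \<ge> 2\<close> show False by simp
qed

lemma theta_minus_nth: "fps_nth theta_minus 0 = 1" "fps_nth theta_minus (Suc 0) = -2"
  using theta_minus_cong[of 1] unfolding fps_X_power_dvd_iff by (auto simp: less_Suc_eq)

lemma distinct_prod_nth_0: "fps_nth distinct_prod 0 = 1"
  using prodinf_cong_partial_prod[OF near_one_basic(2), of 0]
  unfolding fps_X_power_dvd_iff distinct_prod_def by simp

text \<open>
  Let \<open>E\<close> be the difference of both sides. Squaring \<open>\<phi>(q) + \<phi>(-q) = 2 \<phi>(q^4)\<close> and
  inserting \<open>\<phi>(q) \<phi>(-q) = \<phi>(-q^2)^2\<close> rewrites it as \<open>-2 E(q^2)\<close>, so that \<open>E = 0\<close>.
\<close>
lemma theta_squares_add: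
  "flip theta_minus ^ 2 + theta_minus ^ 2 = 2 * sq (flip theta_minus) ^ 2"
proof -
  define A where "A = flip theta_minus"
  define E where "E = A ^ 2 + theta_minus ^ 2 - 2 * sq A ^ 2"
  have 1: "theta_minus + A = 2 * sq (sq A)" and 2: "theta_minus * A = sq theta_minus ^ 2"
    using theta_minus_plus_flip theta_minus_mult_flip by (simp_all add: A_def)
  have "E = 4 * sq (sq A) ^ 2 - 2 * sq theta_minus ^ 2 - 2 * sq A ^ 2"
    using arg_cong[OF 1, of "\<lambda>x. x ^ 2"] 2[symmetric]
    by (simp add: E_def power2_eq_square algebra_simps)
  also have "\<dots> = fps_const (-2) * sq E"
    by (simp add: E_def compose_hom algebra_simps flip: numeral_fps_const neg_numeral_fps_const)
  finally have "E = 0"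
    by (rule eq_zero_if_eq_scaled_sq)
      (simp add: E_def A_def theta_minus_nth fps_nth_power_0)
  then show ?thesis by (simp add: E_def A_def)
qed

text \<open>
  Both sides are \<open>8 q + O(q^2)\<close> and solve \<open>f(q)^2 = 8 \<phi>(q^4)^2 f(q^2)\<close>: the left-hand side because
  \<open>(A^2 - B^2)^2 = (A^2 + B^2)^2 - 4 A^2 B^2\<close> is expressed by theta series in \<open>q^2\<close>,
  the right-hand side by its product.
  In classical notation this is \<open>\<phi>(q)^2 - \<phi>(-q)^2 = 8 q \<psi>(q^4)^2\<close>.
\<close>
lemma theta_squares_diff:
  "flip theta_minus ^ 2 - theta_minus ^ 2 = 8 * theta_minus ^ 2 * G8"
proof (rule square_eq_mult_sq_unique)
  define A B C D R where "A = flip theta_minus" and "B = theta_minus" and "C = sq B" and "D = sq A"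
    and "R = distinct_prod"
  note defs = A_def B_def C_def D_def R_def
  have AB: "A * B = C ^ 2" and squares: "A ^ 2 + B ^ 2 = 2 * D ^ 2"
    using theta_minus_mult_flip theta_squares_add by (simp_all add: defs mult.commute)
  have sq_squares: "D ^ 2 + C ^ 2 = 2 * sq D ^ 2"
    using arg_cong[OF squares, of sq] by (simp add: compose_hom C_def D_def)
  have BR: "B * R ^ 2 = C * sq R"
    using theta_minus_distinct_prod by (simp add: defs mult.commute)
  have sq_BR: "C * sq R ^ 2 = sq C * sq (sq R)"
    using arg_cong[OF BR, of sq] by (simp add: compose_hom C_def)
  have sq_sq_BR: "sq C * sq (sq R) ^ 2 = sq (sq C) * sq (sq (sq R))"
    using arg_cong[OF sq_BR, of sq] by (simp add: compose_hom)
  have sq_sq_AB: "sq D * sq C = sq (sq C) ^ 2"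
    using arg_cong[OF arg_cong[OF AB, of sq], of sq] by (simp add: compose_hom C_def D_def)
  have nz: "C \<noteq> 0" "sq C \<noteq> 0"
    by (intro fps_nth_0_one_imp_nz; simp add: defs theta_minus_nth)+
  have G8: "G8 = fps_X * R ^ 4 * sq R ^ 2 * sq (sq R) ^ 4"
    by (simp add: G8_distinct_prod R_def)
  have sq_G8: "sq G8 = fps_X ^ 2 * sq R ^ 4 * sq (sq R) ^ 2 * sq (sq (sq R)) ^ 4"
    unfolding G8 by (simp add: compose_hom)
  show "(flip theta_minus ^ 2 - theta_minus ^ 2) ^ 2 =
      (8 * sq D ^ 2) * sq (flip theta_minus ^ 2 - theta_minus ^ 2)"
  proof -
    have "(A ^ 2 - B ^ 2) ^ 2 = 8 * sq D ^ 2 * (D ^ 2 - C ^ 2)"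
      using AB squares sq_squares by algebra
    then show ?thesis by (simp add: compose_hom defs)
  qed
  show "(8 * theta_minus ^ 2 * G8) ^ 2 = (8 * sq D ^ 2) * sq (8 * theta_minus ^ 2 * G8)"
  proof -
    define r2 r4 r8 c4 c8 d4 where "r2 = sq R" and "r4 = sq (sq R)" and "r8 = sq (sq (sq R))"
      and "c4 = sq C" and "c8 = sq (sq C)" and "d4 = sq D"
    note abbr = r2_def r4_def r8_def c4_def c8_def d4_def
    have BR': "B * R ^ 2 = C * r2" and sq_BR': "C * r2 ^ 2 = c4 * r4"
      and sq_sq_BR': "c4 * r4 ^ 2 = c8 * r8" and sq_sq_AB': "d4 * c4 = c8 ^ 2"
      and G8': "G8 = fps_X * R ^ 4 * r2 ^ 2 * r4 ^ 4"
      and sq_G8': "sq G8 = fps_X ^ 2 * r2 ^ 4 * r4 ^ 2 * r8 ^ 4" and "c4 \<noteq> 0"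
      using BR sq_BR sq_sq_BR sq_sq_AB G8 sq_G8 nz by (simp_all only: abbr simp_thms)
    have a: "B ^ 4 * R ^ 8 = C ^ 2 * (C * r2 ^ 2) ^ 2"
    proof -
      have "B ^ 4 * R ^ 8 = (B * R ^ 2) ^ 4" by algebra
      then show ?thesis unfolding BR' by algebra
    qed
    have "c4 ^ 2 * (c4 ^ 2 * r4 ^ 8) = c4 ^ 2 * (d4 ^ 2 * r8 ^ 4)"
    proof -
      have "c4 ^ 2 * (c4 ^ 2 * r4 ^ 8) = (c4 * r4 ^ 2) ^ 4" by algebra
      also have "\<dots> = (c8 ^ 2) ^ 2 * r8 ^ 4"
        unfolding sq_sq_BR' by algebra
      also have "\<dots> = c4 ^ 2 * (d4 ^ 2 * r8 ^ 4)"
        unfolding sq_sq_AB'[symmetric] by algebra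
      finally show ?thesis .
    qed
    then have b: "c4 ^ 2 * r4 ^ 8 = d4 ^ 2 * r8 ^ 4"
      using mult_left_cancel[of "c4 ^ 2"] \<open>c4 \<noteq> 0\<close> by (metis power_not_zero)
    have "(8 * B ^ 2 * G8) ^ 2 = 64 * fps_X ^ 2 * (B ^ 4 * R ^ 8) * r2 ^ 4 * r4 ^ 8"
      unfolding G8' by algebra
    also have "\<dots> = 64 * fps_X ^ 2 * C ^ 2 * r2 ^ 4 * r4 ^ 2 * (c4 ^ 2 * r4 ^ 8)"
      unfolding a sq_BR' by algebra
    also have "\<dots> = 8 * d4 ^ 2 * (8 * C ^ 2 * sq G8)"
      unfolding b sq_G8' by algebra
    finally show ?thesis by (simp add: compose_hom C_def B_def d4_def)
  qed
qed (simp_all add: theta_minus_nth fps_nth_power_0 G8_distinct_prod distinct_prod_nth_0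
      power2_eq_square fps_mult_nth_1 fps_compose_uminus')

section \<open>The modular equation\<close>

text \<open>
  Comparing the exponents of \<open>distinct_prod\<close> gives \<open>G2 B^6 = G8 A^4 D^2\<close> with \<open>D = \<phi>(q^2)\<close>. The quadratic
  theta identities turn \<open>8 B^2 G8\<close> into \<open>A^2 - B^2\<close> and \<open>2 D^2\<close> into \<open>A^2 + B^2\<close>.
\<close>
lemma G2_theta: "16 * G2 * theta_minus ^ 8 = flip theta_minus ^ 8 - flip theta_minus ^ 4 * theta_minus ^ 4"
proof -
  define A B C D R where "A = flip theta_minus" and "B = theta_minus" and "C = sq B" and "D = sq A"
    and "R = distinct_prod"
  note defs = A_def B_def C_def D_def R_def
  define r2 r4 c4 where "r2 = sq R" and "r4 = sq (sq R)" and "c4 = sq C"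
  have AB: "A * B = C ^ 2" and squares: "A ^ 2 + B ^ 2 = 2 * D ^ 2"
    and diff: "A ^ 2 - B ^ 2 = 8 * B ^ 2 * G8"
    using theta_minus_mult_flip theta_squares_add theta_squares_diff
    by (simp_all add: defs mult.commute)
  have BR: "C * r2 = B * R ^ 2"
    using theta_minus_distinct_prod by (simp add: defs r2_def mult.commute)
  have sq_BR: "c4 * r4 = C * r2 ^ 2"
    using arg_cong[OF BR, of sq] by (simp add: compose_hom C_def r2_def r4_def c4_def)
  have sq_AB: "D * C = c4 ^ 2"
    using arg_cong[OF AB, of sq] by (simp add: compose_hom C_def D_def c4_def)
  have G8: "G8 = fps_X * R ^ 4 * r2 ^ 2 * r4 ^ 4" and G2: "G2 = fps_X * R ^ 24"
    by (simp_all add: G8_distinct_prod G2_distinct_prod R_def r2_def r4_def)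
  have nz: "B \<noteq> 0" "C \<noteq> 0"
    by (intro fps_nth_0_one_imp_nz; simp add: defs theta_minus_nth)+
  have "C ^ 2 * (r4 ^ 4 * D ^ 2) = (c4 ^ 2) ^ 2 * r4 ^ 4"
    unfolding sq_AB[symmetric] by algebra
  also have "\<dots> = (c4 * r4) ^ 4" by algebra
  also have "\<dots> = C ^ 2 * (C ^ 2 * r2 ^ 8)" unfolding sq_BR by algebra
  finally have r4: "r4 ^ 4 * D ^ 2 = C ^ 2 * r2 ^ 8"
    using mult_left_cancel[of "C ^ 2"] nz by (metis power_not_zero)
  have "B ^ 4 * (G8 * A ^ 4 * D ^ 2) = fps_X * R ^ 4 * r2 ^ 2 * (A * B) ^ 4 * (r4 ^ 4 * D ^ 2)"
    unfolding G8 by algebra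
  also have "\<dots> = fps_X * R ^ 4 * (C * r2) ^ 10" unfolding r4 AB by algebra
  also have "\<dots> = B ^ 4 * (G2 * B ^ 6)" unfolding BR G2 by algebra
  finally have "G8 * A ^ 4 * D ^ 2 = G2 * B ^ 6"
    using mult_left_cancel[of "B ^ 4"] nz by (metis power_not_zero)
  then have "16 * G2 * B ^ 8 = (8 * B ^ 2 * G8) * (2 * D ^ 2) * A ^ 4" by algebra
  also have "\<dots> = A ^ 8 - A ^ 4 * B ^ 4"
    unfolding diff[symmetric] squares[symmetric] by algebra
  finally show ?thesis by (simp only: A_def B_def)
qed

text \<open>The quotient \<open>v = \<phi>(q) / \<phi>(-q)\<close>, which \<open>q \<mapsto> -q\<close> inverts.\<close>
definition theta_ratio :: "rat fps" where
  "theta_ratio = flip theta_minus * Phi2"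

lemma theta_ratio_mult_flip: "theta_ratio * flip theta_ratio = 1"
proof -
  have "flip Phi2 * flip theta_minus = 1"
    using arg_cong[OF Phi2_theta_minus, of flip] by (simp add: compose_hom)
  then show ?thesis using Phi2_theta_minus
    by (simp add: theta_ratio_def compose_hom flip_flip mult_ac)
qed

lemma G2_theta_ratio: "16 * G2 = theta_ratio ^ 8 - theta_ratio ^ 4"
proof -
  have "16 * G2 = (16 * G2 * theta_minus ^ 8) * Phi2 ^ 8"
    using Phi2_theta_minus by (simp add: mult.assoc mult.commute flip: power_mult_distrib)
  also have "\<dots> = (flip theta_minus * Phi2) ^ 8 -
      (flip theta_minus * Phi2) ^ 4 * (Phi2 * theta_minus) ^ 4"
    unfolding G2_theta by algebra
  finally show ?thesis by (simp add: Phi2_theta_minus theta_ratio_def)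
qed

lemma sq_G8_theta_ratio: "16 * sq G8 = theta_ratio + flip theta_ratio - 2"
proof -
  define A B C D where "A = flip theta_minus" and "B = theta_minus" and "C = sq B" and "D = sq A"
  define i j where "i = flip Phi2" and "j = Phi2"
  note defs = A_def B_def C_def D_def i_def j_def
  have AB: "A * B = C ^ 2" and squares: "A ^ 2 + B ^ 2 = 2 * D ^ 2"
    and diff: "A ^ 2 - B ^ 2 = 8 * B ^ 2 * G8" and j: "j * B = 1"
    using theta_minus_mult_flip theta_squares_add theta_squares_diff Phi2_theta_minus
    by (simp_all add: defs mult.commute)
  have i: "i * A = 1"
    using arg_cong[OF j, of flip] by (simp add: compose_hom defs)
  have "D ^ 2 - C ^ 2 = 8 * C ^ 2 * sq G8"
    using arg_cong[OF diff, of sq] by (simp add: compose_hom C_def D_def)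
  then have "A ^ 2 + B ^ 2 - 2 * (A * B) = 16 * sq G8 * (A * B)"
    unfolding squares AB by algebra
  then have "i * j * (A ^ 2 + B ^ 2 - 2 * (A * B)) = i * j * (16 * sq G8 * (A * B))" by simp
  then have "16 * sq G8 * ((i * A) * (j * B)) = (i * A) * (A * j) + (j * B) * (B * i) - 2 * ((i * A) * (j * B))"
    by algebra
  then show ?thesis unfolding i j
    by (simp add: theta_ratio_def compose_hom flip_flip defs)
qed

text \<open>
  Since \<open>1 + v = (\<phi>(q) + \<phi>(-q)) / \<phi>(-q) = 2 \<phi>(q^4) Phi2(q)\<close>, the factor \<open>Phi2(q)\<close> is \<open>1 + v\<close> times a
  series in \<open>q^4\<close>; the latter accounts for the factor \<open>Phi2(-q^2)\<close> in the theorem.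
\<close>
lemma Phi2_theta_ratio: "2 * Phi2 = sq (sq (flip Phi2)) * (1 + theta_ratio)"
proof -
  have "sq (sq (flip Phi2)) * (2 * sq (sq (flip theta_minus))) = 2"
    using arg_cong[OF Phi2_theta_minus, of "\<lambda>f. sq (sq (flip f))"] by (simp add: compose_hom mult_ac)
  then have "sq (sq (flip Phi2)) * (theta_minus + flip theta_minus) * Phi2 = 2 * Phi2"
    unfolding theta_minus_plus_flip by simp
  moreover have "sq (sq (flip Phi2)) * (theta_minus + flip theta_minus) * Phi2 =
      sq (sq (flip Phi2)) * (Phi2 * theta_minus + theta_ratio)"
    by (simp add: theta_ratio_def algebra_simps)
  ultimately show ?thesis by (simp only: Phi2_theta_minus)
qed

definition eval_int_poly :: "int poly \<Rightarrow> 'a::comm_ring_1 \<Rightarrow> 'a" where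
  "eval_int_poly p = poly (map_poly of_int p)"

lemma eval_int_poly_simps [simp]:
  "eval_int_poly 0 x = 0"
  "eval_int_poly (pCons c p) x = of_int c + x * eval_int_poly p x"
  by (simp_all add: eval_int_poly_def map_poly_pCons)

lemma eval_int_poly_add:
  "eval_int_poly (p + q) x = eval_int_poly p x + eval_int_poly q x"
proof -
  have "map_poly of_int (p + q) = map_poly of_int p + (map_poly of_int q :: 'a poly)"
    by (rule poly_eqI) (simp add: coeff_map_poly)
  then show ?thesis by (simp add: eval_int_poly_def)
qed

lemma eval_int_poly_mult:
  "eval_int_poly (p * q) x = eval_int_poly p x * eval_int_poly q x"
proof -
  have "map_poly of_int (p * q) = map_poly of_int p * (map_poly of_int q :: 'a poly)"
    by (rule poly_eqI) (simp add: coeff_map_poly coeff_mult)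
  then show ?thesis by (simp add: eval_int_poly_def)
qed

lemma eval_int_poly_eq_sum:
  assumes "degree p \<le> n"
  shows "eval_int_poly p x = (\<Sum>r\<le>n. of_int (coeff p r) * x ^ r)"
proof -
  have "degree (map_poly of_int p :: 'a poly) \<le> n"
    using assms by (intro degree_le) (auto simp: coeff_map_poly coeff_eq_0)
  then have "eval_int_poly p x = (\<Sum>r\<le>n. coeff (map_poly of_int p) r * x ^ r)"
    unfolding eval_int_poly_def poly_altdef
    by (intro sum.mono_neutral_left) (auto simp: coeff_eq_0)
  then show ?thesis by (simp add: coeff_map_poly)
qed

lemma sq_eval_int_poly: "sq (eval_int_poly p x) = eval_int_poly p (sq x)"
  by (induction p) (simp_all add: compose_hom flip: fps_of_int)

text \<open>
  The polynomial \<open>g(y) = y (1 + 8 y)^2 (1 + 4 y)\<close>, which expresses \<open>G2\<close> through \<open>y = G8\<close>.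
\<close>
definition level2_in_level8 :: "int poly" where
  "level2_in_level8 = [:0, 1, 20, 128, 256:]"

text \<open>
  The polynomial \<open>\<sigma> = 48 g + 4096 g^2\<close>. Its value at \<open>G8(q^2)\<close> is \<open>G2(q) + G2(-q)\<close>.
\<close>
definition trace_poly :: "int poly" where
  "trace_poly = [:0, 48, 5056, 169984, 2699264, 23068672, 109051904, 268435456, 268435456:]"

text \<open>
  The image of \<open>Phi2(-q) G2(-q)^s\<close> under \<open>U2\<close>, divided by \<open>Phi2(-q^2)\<close>, as a polynomial in \<open>G8\<close>.
  With \<open>16 t = v + 1 / v - 2\<close>, the case \<open>s = 1\<close> is the polynomial \<open>p\<close> for which \<open>64 p(t)\<close> is the sum
  of \<open>v^9 + v^8 - v^5 - v^4\<close> and its image under \<open>v \<mapsto> 1 / v\<close>.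
\<close>
fun U2_poly :: "nat \<Rightarrow> int poly" where
  "U2_poly 0 = [:1, 4:]"
| "U2_poly (Suc 0) = [:0, 26, 3224, 128960, 2489344, 26836992, 170393600, 633339904, 1275068416, 1073741824:]"
| "U2_poly (Suc (Suc s)) = trace_poly * U2_poly (Suc s) + level2_in_level8 * U2_poly s"

text \<open>
  The value \<open>T\<close> of \<open>g\<close> at \<open>t\<close> satisfies \<open>256 T = v^4 + v'^4 - 2\<close>. Multiplied by 256, the claim becomes an
  identity of Laurent polynomials in \<open>v^4\<close>.
\<close>
lemma root_of_modular_equation:
  fixes v v' a t :: "'a::{idom,semiring_char_0}"
  assumes "v * v' = 1" "16 * t = v + v' - 2" "16 * a = v ^ 8 - v ^ 4"
  shows "a ^ 2 = eval_int_poly trace_poly t * a + eval_int_poly level2_in_level8 t"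
proof -
  define T where "T = eval_int_poly level2_in_level8 t"
  have trace: "eval_int_poly trace_poly t = 48 * T + 4096 * T ^ 2"
    by (simp add: T_def level2_in_level8_def trace_poly_def) algebra
  have T: "T = t * (1 + 8 * t) ^ 2 * (1 + 4 * t)"
    by (simp add: T_def level2_in_level8_def) algebra
  have "256 * T = (16 * t) * ((16 * t + 2) ^ 2) * (16 * t + 4)"
    unfolding T by algebra
  also have "\<dots> = v ^ 4 + v' ^ 4 - 2"
    unfolding assms(2) using assms(1) by algebra
  finally have T': "256 * T = v ^ 4 + v' ^ 4 - 2" .
  have "256 * (a ^ 2) = (16 * a) ^ 2" by algebra
  also have "\<dots> = (3 * (v ^ 4 + v' ^ 4 - 2) + (v ^ 4 + v' ^ 4 - 2) ^ 2) * (v ^ 8 - v ^ 4)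
      + (v ^ 4 + v' ^ 4 - 2)"
    unfolding assms(3) using assms(1) by algebra
  also have "\<dots> = (3 * (256 * T) + (256 * T) ^ 2) * (16 * a) + 256 * T"
    unfolding T' assms(3) ..
  also have "\<dots> = 256 * ((48 * T + 4096 * T ^ 2) * a + T)" by algebra
  finally show ?thesis
    unfolding trace T_def[symmetric] by (simp only: mult_left_cancel zero_neq_numeral[symmetric] simp_thms)
qed

text \<open>
  The left-hand side is the symmetrisation of \<open>Phi2(-q) G2(-q)^s\<close> up to a factor that depends on \<open>q^2\<close>
  only. The recurrence holds because \<open>a\<close> and \<open>b\<close> are roots of the same quadratic equation.
\<close>
lemma trace_eq_U2_poly:
  fixes v v' a b t :: "'a::{idom,semiring_char_0}"
  assumes v: "v * v' = 1" and t: "16 * t = v + v' - 2"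
    and a: "16 * a = v' ^ 8 - v' ^ 4" and b: "16 * b = v ^ 8 - v ^ 4"
  shows "(1 + v') * a ^ s + (1 + v) * b ^ s = 4 * eval_int_poly (U2_poly s) t"
proof (induction s rule: U2_poly.induct)
  case 1
  show ?case using t by (simp add: algebra_simps)
next
  case 2
  \<comment> \<open>Power sums \<open>v^n + v'^n\<close> are polynomials in \<open>w = v + v'\<close>, because \<open>v v' = 1\<close>.\<close>
  define w where "w = v + v'"
  have "16 * ((1 + v') * a + (1 + v) * b) =
      (v ^ 9 + v' ^ 9) + (v ^ 8 + v' ^ 8) - (v ^ 5 + v' ^ 5) - (v ^ 4 + v' ^ 4)"
    using a b by algebra
  also have "v ^ 4 + v' ^ 4 = (w ^ 2 - 2) ^ 2 - 2" (is "_ = ?p4")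
    unfolding w_def using v by algebra
  also have "v ^ 5 + v' ^ 5 = ?p4 * w - (w ^ 3 - 3 * w)"
    unfolding w_def using v by algebra
  also have "v ^ 8 + v' ^ 8 = ?p4 ^ 2 - 2"
    unfolding w_def using v by algebra
  also have "v ^ 9 + v' ^ 9 = (?p4 ^ 2 - 2) * w - ?p4 * (w ^ 3 - 3 * w) + w"
    unfolding w_def using v by algebra
  also have "w = 16 * t + 2" using t by (simp add: w_def)
  also have "((((16 * t + 2) ^ 2 - 2) ^ 2 - 2) ^ 2 - 2) * (16 * t + 2) -
        (((16 * t + 2) ^ 2 - 2) ^ 2 - 2) * ((16 * t + 2) ^ 3 - 3 * (16 * t + 2)) + (16 * t + 2) +
      ((((16 * t + 2) ^ 2 - 2) ^ 2 - 2) ^ 2 - 2) -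
      ((((16 * t + 2) ^ 2 - 2) ^ 2 - 2) * (16 * t + 2) - ((16 * t + 2) ^ 3 - 3 * (16 * t + 2))) -
      (((16 * t + 2) ^ 2 - 2) ^ 2 - 2) =
      16 * (4 * eval_int_poly (U2_poly (Suc 0)) t)"
    by (simp only: U2_poly.simps eval_int_poly_simps of_int_numeral of_int_0) algebra
  finally show ?case
    by (simp only: mult_left_cancel zero_neq_numeral[symmetric] simp_thms power_one_right
        flip: One_nat_def)
next
  case (3 s)
  have "v' * v = 1" "16 * t = v' + v - 2" using v t by (simp_all add: mult.commute add.commute)
  note ra = root_of_modular_equation[OF this a] and rb = root_of_modular_equation[OF v t b]
  define \<tau> \<nu> where "\<tau> = eval_int_poly trace_poly t" and "\<nu> = eval_int_poly level2_in_level8 t"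
  have "(1 + v') * a ^ Suc (Suc s) + (1 + v) * b ^ Suc (Suc s) =
      (1 + v') * a ^ s * a ^ 2 + (1 + v) * b ^ s * b ^ 2"
    by (simp add: power2_eq_square mult_ac)
  also have "\<dots> = \<tau> * ((1 + v') * a ^ Suc s + (1 + v) * b ^ Suc s) +
      \<nu> * ((1 + v') * a ^ s + (1 + v) * b ^ s)"
    unfolding ra rb \<tau>_def[symmetric] \<nu>_def[symmetric] by (simp add: algebra_simps)
  also have "\<dots> = 4 * eval_int_poly (U2_poly (Suc (Suc s))) t"
    unfolding 3 by (simp add: eval_int_poly_add eval_int_poly_mult \<tau>_def \<nu>_def algebra_simps)
  finally show ?case .
qed

section \<open>Two-adic weights\<close>

text \<open>
  For \<open>2 r \<ge> s\<close> the second condition says that the coefficient is divisible by \<open>2^(2r - s)\<close>; in the form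
  given here, \<open>p(x / 4)\<close> has its coefficients in \<open>2^(-s) \<int>\<close>, it is visibly multiplicative.
\<close>
definition two_adic_weight :: "nat \<Rightarrow> int poly \<Rightarrow> bool" where
  "two_adic_weight s p \<longleftrightarrow> (\<forall>r. (2 * r < s \<longrightarrow> coeff p r = 0) \<and> 4 ^ r dvd 2 ^ s * coeff p r)"

lemma two_adic_weight_add:
  "two_adic_weight s p \<Longrightarrow> two_adic_weight s q \<Longrightarrow> two_adic_weight s (p + q)"
  by (simp add: two_adic_weight_def distrib_left)

lemma two_adic_weight_mult:
  assumes p: "two_adic_weight s p" and q: "two_adic_weight t q"
  shows "two_adic_weight (s + t) (p * q)"
  unfolding two_adic_weight_def
proof (intro allI conjI impI)
  fix r
  show "coeff (p * q) r = 0" if "2 * r < s + t"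
  proof -
    have "coeff p i * coeff q (r - i) = 0" if "i \<le> r" for i
    proof -
      have "2 * i < s \<or> 2 * (r - i) < t" using that \<open>2 * r < s + t\<close> by linarith
      then show ?thesis using p q by (auto simp: two_adic_weight_def)
    qed
    then show ?thesis by (simp only: coeff_mult) (intro sum.neutral ballI, simp)
  qed
  have "4 ^ r dvd 2 ^ (s + t) * (coeff p i * coeff q (r - i))" if "i \<le> r" for i
  proof -
    have "4 ^ i * 4 ^ (r - i) dvd (2 ^ s * coeff p i) * (2 ^ t * coeff q (r - i))"
      using p q by (intro mult_dvd_mono) (simp_all add: two_adic_weight_def)
    then show ?thesis using that by (simp add: power_add[symmetric]) (simp add: power_add mult_ac)
  qed
  then show "4 ^ r dvd 2 ^ (s + t) * coeff (p * q) r"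
    by (auto simp: coeff_mult sum_distrib_left intro!: dvd_sum)
qed

lemma two_adic_weight_PolyI:
  assumes "list_all (\<lambda>(r, c). (2 * r < s \<longrightarrow> c = 0) \<and> 4 ^ r dvd 2 ^ s * c) (List.enumerate 0 cs)"
  shows "two_adic_weight s (Poly cs)"
proof -
  have "(2 * r < s \<longrightarrow> cs ! r = 0) \<and> 4 ^ r dvd 2 ^ s * cs ! r" if "r < length cs" for r
    using assms that by (auto simp: list_all_length nth_enumerate_eq)
  then show ?thesis by (auto simp: two_adic_weight_def nth_default_def)
qed

text \<open>
  The recurrence goes up by one step with the weight 1 of \<open>trace_poly\<close> and by two steps with the weight
  2 of \<open>level2_in_level8\<close>.
\<close>
lemma two_adic_weight_U2_poly: "two_adic_weight s (U2_poly s)"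
proof (induction s rule: U2_poly.induct)
  case 1
  show ?case using two_adic_weight_PolyI[of 0 "[1, 4]"] by simp
next
  case 2
  show ?case
    using two_adic_weight_PolyI[of 1 "[0, 26, 3224, 128960, 2489344, 26836992, 170393600,
      633339904, 1275068416, 1073741824]"] by simp
next
  case (3 s)
  have "two_adic_weight 1 trace_poly"
    using two_adic_weight_PolyI[of 1 "[0, 48, 5056, 169984, 2699264, 23068672, 109051904,
      268435456, 268435456]"] by (simp add: trace_poly_def)
  from two_adic_weight_mult[OF this 3(1)]
  have "two_adic_weight (Suc (Suc s)) (trace_poly * U2_poly (Suc s))" by simp
  moreover have "two_adic_weight 2 level2_in_level8"
    using two_adic_weight_PolyI[of 2 "[0, 1, 20, 128, 256]"] by (simp add: level2_in_level8_def)
  from two_adic_weight_mult[OF this 3(2)]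
  have "two_adic_weight (Suc (Suc s)) (level2_in_level8 * U2_poly s)" by simp
  ultimately show ?case by (simp add: two_adic_weight_add)
qed

lemma degree_U2_poly: "degree (U2_poly s) \<le> 8 * s + 1"
proof (induction s rule: U2_poly.induct)
  case (3 s)
  have "degree trace_poly \<le> 8" "degree level2_in_level8 \<le> 4"
    by (simp_all add: trace_poly_def level2_in_level8_def)
  then have "degree (trace_poly * U2_poly (Suc s)) \<le> 8 * Suc (Suc s) + 1"
    "degree (level2_in_level8 * U2_poly s) \<le> 8 * Suc (Suc s) + 1"
    using 3 by (intro order_trans[OF degree_mult_le]; simp)+
  then show ?case by (simp add: degree_add_le)
qed simp_all

section \<open>The action of U2\<close>

text \<open>
  The sum \<open>F(q) + F(-q)\<close> is twice the even part of \<open>F\<close>, and \<open>U2\<close> reads off the even part as a series in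
  \<open>q^2\<close>.
\<close>
lemma U2_eqI:
  assumes "F + flip F = 2 * sq H"
  shows "U2 F = H"
proof (rule fps_ext)
  fix n
  have "fps_nth (F + flip F) (2 * n) = 2 * fps_nth F (2 * n)"
    by (simp add: fps_compose_uminus')
  moreover have "fps_nth (2 * sq H) (2 * n) = 2 * fps_nth H n"
    using sq_nth_even[of H n] by (simp add: fps_numeral_nth numeral_fps_const)
  ultimately show "fps_nth (U2 F) n = fps_nth H n"
    using assms by (simp add: U2_def)
qed

lemma U2_Phi2_G2_power:
  "U2 (flip Phi2 * flip G2 ^ s) = sq (flip Phi2) * eval_int_poly (U2_poly s) G8"
proof (rule U2_eqI)
  define F where "F = flip Phi2 * flip G2 ^ s"
  define v v' w where "v = theta_ratio" and "v' = flip theta_ratio" and "w = sq (sq (flip Phi2))"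
  have v: "v * v' = 1" and t: "16 * sq G8 = v + v' - 2" and b: "16 * G2 = v ^ 8 - v ^ 4"
    and j: "2 * Phi2 = w * (1 + v)"
    using theta_ratio_mult_flip sq_G8_theta_ratio G2_theta_ratio Phi2_theta_ratio
    by (simp_all add: v_def v'_def w_def)
  have a: "16 * flip G2 = v' ^ 8 - v' ^ 4"
    using arg_cong[OF b, of flip] by (simp add: compose_hom v_def v'_def)
  have i: "2 * flip Phi2 = w * (1 + v')"
    using arg_cong[OF j, of flip] by (simp add: compose_hom v_def v'_def w_def flip_sq)
  have flip_F: "flip F = Phi2 * G2 ^ s"
    by (simp add: F_def compose_hom flip_flip)
  have "2 * (F + flip F) = w * ((1 + v') * flip G2 ^ s + (1 + v) * G2 ^ s)"
    (is "_ = ?rhs")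
  proof -
    have "2 * (F + flip F) = (2 * flip Phi2) * flip G2 ^ s + (2 * Phi2) * G2 ^ s"
      by (simp only: flip_F distrib_left mult.assoc) (simp only: F_def)
    also have "\<dots> = ?rhs" unfolding i j
      by (simp only: ring_distribs mult.assoc mult_1_left mult_1_right)
    finally show ?thesis .
  qed
  also have "\<dots> = 2 * (2 * (w * eval_int_poly (U2_poly s) (sq G8)))"
    unfolding trace_eq_U2_poly[OF v t a b] by simp
  finally have "F + flip F = 2 * (w * eval_int_poly (U2_poly s) (sq G8))"
    by (simp only: mult_left_cancel zero_neq_numeral[symmetric] simp_thms)
  also have "w * eval_int_poly (U2_poly s) (sq G8) = sq (sq (flip Phi2) * eval_int_poly (U2_poly s) G8)"
    by (simp add: w_def compose_hom sq_eval_int_poly)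
  finally show "flip Phi2 * flip G2 ^ s + flip (flip Phi2 * flip G2 ^ s) =
      2 * sq (sq (flip Phi2) * eval_int_poly (U2_poly s) G8)"
    unfolding F_def .
qed

theorem theorem3p9:
  fixes s :: nat
  shows "\<exists>c :: nat \<Rightarrow> int.
    U2 (fps_compose Phi2 (- fps_X) * fps_compose G2 (- fps_X) ^ s) =
      fps_compose Phi2 (- (fps_X ^ 2)) *
        (\<Sum>r = nat \<lceil>real s / 2\<rceil>..8 * s + 1. of_int (c r) * G8 ^ r) \<and>
    (\<forall>r \<in> {nat \<lceil>real s / 2\<rceil>..8 * s + 1}. pi2 (c r) \<ge> enat (2 * r - s))"
proof (intro exI conjI ballI)
  let ?c = "coeff (U2_poly s)"
  note weight = two_adic_weight_U2_poly[of s, unfolded two_adic_weight_def, rule_format]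
  have low: "nat \<lceil>real s / 2\<rceil> \<le> r \<longleftrightarrow> s \<le> 2 * r" for r
    by (simp add: ceiling_le_iff nat_le_iff) linarith
  have "eval_int_poly (U2_poly s) G8 = (\<Sum>r\<le>8 * s + 1. of_int (?c r) * G8 ^ r)"
    by (rule eval_int_poly_eq_sum[OF degree_U2_poly])
  also have "\<dots> = (\<Sum>r = nat \<lceil>real s / 2\<rceil>..8 * s + 1. of_int (?c r) * G8 ^ r)"
    using weight by (intro sum.mono_neutral_right) (auto simp: low not_le)
  finally show "U2 (fps_compose Phi2 (- fps_X) * fps_compose G2 (- fps_X) ^ s) =
      fps_compose Phi2 (- (fps_X ^ 2)) *
        (\<Sum>r = nat \<lceil>real s / 2\<rceil>..8 * s + 1. of_int (?c r) * G8 ^ r)"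
    using U2_Phi2_G2_power[of s] by (simp add: sq_flip)
  fix r assume "r \<in> {nat \<lceil>real s / 2\<rceil>..8 * s + 1}"
  then have "2 * r = s + (2 * r - s)" by (simp add: low)
  then have "(2 :: int) ^ (2 * r) = 2 ^ s * 2 ^ (2 * r - s)"
    by (metis power_add)
  then have "(4 :: int) ^ r = 2 ^ s * 2 ^ (2 * r - s)" by (simp add: power_mult)
  then have "2 ^ (2 * r - s) dvd ?c r"
    using weight[of r] by simp
  then show "pi2 (?c r) \<ge> enat (2 * r - s)"
    by (auto simp: pi2_def intro!: multiplicity_geI)
qed

end
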